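(* Let $P=UU^T\in\mathrm{Gr}(n,p)$ with $U\in\mathrm{St}(n,p)$ and let $\Delta,\tilde\Delta\in T_P\mathrm{Gr}(n,p)$ be such that $\Delta^{\mathsf{hor}}_U$ has mutually distinct, non-zero singular values. Let $\Delta^{\mathsf{hor}}_U=Q\Sigma V^T$ and $(\Delta+t\tilde\Delta)^{\mathsf{hor}}_U=Q(t)\Sigma(t)V(t)^T$ be compact SVDs of the horizontal lifts of $\Delta$ and $\Delta+t\tilde\Delta$, respectively, where for $t$ near $0$ the factors depend differentiably on $t$ and $Q(0)=Q$, $\Sigma(0)=\Sigma$, $V(0)=V$. Write $\dot Q=\frac{\mathrm d}{\mathrm dt}\big|_{t=0}Q(t)$, and likewise $\dot\Sigma,\dot V$. Let $$Y:=UV\cos(\Sigma)+Q\sin(\Sigma)\in\mathrm{St}(n,p)$$ and $$\Gamma:=U\dot V\cos(\Sigma)-UV\sin(\Sigma)\dot\Sigma+\dot Q\sin(\Sigma)+Q\cos(\Sigma)\dot\Sigma\in T_Y\mathrm{St}(n,p).$$ Then the derivative of the Grassmann exponential is given by $$\mathrm d(\mathrm{Exp}^{\mathrm{Gr}}_P)_\Delta(\tilde\Delta)=\Gamma Y^T+Y\Gamma^T\in T_{\mathrm{Exp}^{\mathrm{Gr}}_P(\Delta)}\mathrm{Gr}(n,p)\subseteq\mathbb{R}^{n\times n},$$ and its horizontal lift to $Y$ is accordingly $$\big(\mathrm d(\mathrm{Exp}^{\mathrm{Gr}}_P)_\Delta(\tilde\Delta)\big)^{\mathsf{hor}}_Y=(I_n-YY^T)\Gamma=\Gamma+Y\Gamma^TY\in\mathbb{R}^{n\times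 p}.$$
   Context: Let $1\le p\le n$ be integers. $\mathrm{St}(n,p)=\{U\in\mathbb{R}^{n\times p}: U^TU=I_p\}$, with tangent space $T_U\mathrm{St}(n,p)=\{D\in\mathbb{R}^{n\times p}: U^TD=-D^TU\}$. $\mathrm{Gr}(n,p)=\{P\in\mathbb{R}^{n\times n}: P^T=P,\ P^2=P,\ \mathrm{rank}\,P=p\}$, an embedded submanifold of the symmetric $n\times n$ matrices, with tangent space $T_P\mathrm{Gr}(n,p)=\{\Delta=\Delta^T: \Delta P+P\Delta=\Delta\}$ and Riemannian metric $g_P(\Delta_1,\Delta_2)=\frac12\mathrm{tr}(\Delta_1\Delta_2)$. For $P=UU^T$ with $U\in\mathrm{St}(n,p)$, the horizontal lift of $\Delta\in T_P\mathrm{Gr}(n,p)$ to $U$ is $\Delta^{\mathsf{hor}}_U:=\Delta U\in\{D\in\mathbb{R}^{n\times p}: U^TD=0\}$. $\mathrm{Exp}^{\mathrm{Gr}}_P:T_P\mathrm{Gr}(n,p)\to\mathrm{Gr}(n,p)$ is the Riemannian exponential map; explicitly $\mathrm{Exp}^{\mathrm{Gr}}_P(\Delta)=\exp_m([\Delta,P])\,P\,\exp_m(-[\Delta,P])$, with $\exp_m$ the matrix exponential and $[A,B]=AB-BA$. Its derivative is $\mathrm d(\mathrm{Exp}^{\mathrm{Gr}}_P)_\Delta(\tilde\Delta)=\frac{\mathrm d}{\mathrm dt}\big|_{t=0}\mathrm{Exp}^{\mathrm{Gr}}_P(\Delta+t\tilde\Delta)$. A compact SVD of $X\in\mathbb{R}^{n\times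 p}$ is $X=Q\Sigma V^T$ with $Q\in\mathrm{St}(n,p)$, $\Sigma\in\mathbb{R}^{p\times p}$ diagonal with nonnegative entries, $V\in\mathrm{O}(p)$. Functions $\sin,\cos$ of diagonal matrices act entrywise on the diagonal. *)

theory Defs
  imports "HOL-Analysis.Analysis"
begin

(* An n x p matrix has type real^'p^'n, with n = CARD('n) and p = CARD('p).
   The operations *, ^ and exp on vec types are componentwise or absent, hence
   products are written ** and the matrix exponential is defined below. *)

definition stiefel :: "(real^'p^'n) set" where
  "stiefel = {U. transpose U ** U = mat 1}"

definition stiefel_tangent :: "real^'p^'n \<Rightarrow> (real^'p^'n) set" where
  "stiefel_tangent U = {D. transpose U ** D = - (transpose D ** U)}"

definition grassmann :: "nat \<Rightarrow> (real^'n^'n) set" where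
  "grassmann p = {P. transpose P = P \<and> P ** P = P \<and> rank P = p}"

definition grassmann_tangent :: "real^'n^'n \<Rightarrow> (real^'n^'n) set" where
  "grassmann_tangent P = {D. transpose D = D \<and> D ** P + P ** D = D}"

(* Defined for arbitrary matrices, since the metric of Gr(n,p) is the restriction
   of one inner product on the ambient space of symmetric matrices. *)
definition grassmann_metric :: "real^'n^'n \<Rightarrow> real^'n^'n \<Rightarrow> real^'n^'n \<Rightarrow> real" where
  "grassmann_metric P D1 D2 = trace (D1 ** D2) / 2"

definition horizontal_lift :: "real^'p^'n \<Rightarrow> real^'n^'n \<Rightarrow> real^'p^'n" where
  "horizontal_lift U D = D ** U"

(* The Levi-Civita connection of a submanifold of a Euclidean space is the tangential
   part of the ambient derivative, so geodesics are the curves whose acceleration is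
   normal to the submanifold. Geodesics are parametrized over the whole real line,
   as Gr(n,p) is compact and hence complete. *)
definition grassmann_geodesic :: "nat \<Rightarrow> (real \<Rightarrow> real^'n^'n) \<Rightarrow> bool" where
  "grassmann_geodesic p c \<longleftrightarrow> (\<forall>t. c t \<in> grassmann p) \<and>
     (\<exists>c' c''. (\<forall>t. (c has_vector_derivative c' t) (at t)) \<and>
               (\<forall>t. (c' has_vector_derivative c'' t) (at t)) \<and>
               (\<forall>t. \<forall>D \<in> grassmann_tangent (c t). grassmann_metric (c t) (c'' t) D = 0))"

(* The Riemannian exponential map; grassmann_exp_eq below gives existence and
   uniqueness of the geodesic, and the closed formula. *)
definition grassmann_exp :: "real^'n^'n \<Rightarrow> real^'n^'n \<Rightarrow> real^'n^'n" where
  "grassmann_exp P D = (THE R. \<exists>c. grassmann_geodesic (rank P) c \<and> c 0 = P \<and>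
     (c has_vector_derivative D) (at 0) \<and> R = c 1)"

definition grassmann_dexp :: "real^'n^'n \<Rightarrow> real^'n^'n \<Rightarrow> real^'n^'n \<Rightarrow> real^'n^'n" where
  "grassmann_dexp P D D' = vector_derivative (\<lambda>t. grassmann_exp P (D + t *\<^sub>R D')) (at 0)"

definition compact_svd ::
    "real^'p^'n \<Rightarrow> real^'p^'n \<Rightarrow> real^'p^'p \<Rightarrow> real^'p^'p \<Rightarrow> bool" where
  "compact_svd X Q S V \<longleftrightarrow> Q \<in> stiefel \<and>
     (\<forall>i j. i \<noteq> j \<longrightarrow> S $ i $ j = 0) \<and> (\<forall>i. S $ i $ i \<ge> 0) \<and>
     orthogonal_matrix V \<and> X = Q ** S ** transpose V"

(* The singular values, with multiplicity, are the diagonal entries of the middle factor.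
   Up to order they are the same in every compact SVD. *)
definition distinct_nonzero_singular_values :: "real^'p^'n \<Rightarrow> bool" where
  "distinct_nonzero_singular_values X \<longleftrightarrow>
     (\<exists>Q S V. compact_svd X Q S V \<and> inj (\<lambda>i. S $ i $ i) \<and> (\<forall>i. S $ i $ i \<noteq> 0))"

(* Off the diagonal the value is 0, also for f = cos. *)
definition diag_fun :: "(real \<Rightarrow> real) \<Rightarrow> real^'p^'p \<Rightarrow> real^'p^'p" where
  "diag_fun f S = (\<chi> i j. if i = j then f (S $ i $ i) else 0)"

primrec matrix_power :: "real^'n^'n \<Rightarrow> nat \<Rightarrow> real^'n^'n" where
  "matrix_power A 0 = mat 1"
| "matrix_power A (Suc k) = A ** matrix_power A k"

definition matrix_exp :: "real^'n^'n \<Rightarrow> real^'n^'n" where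
  "matrix_exp A = (\<Sum>k. (1 / fact k) *\<^sub>R matrix_power A k)"


lemma bounded_bilinear_mm: "bounded_bilinear ((**) :: real^'m^'n \<Rightarrow> real^'k^'m \<Rightarrow> real^'k^'n)"
  unfolding bilinear_conv_bounded_bilinear[symmetric] bilinear_def linear_iff
  by (auto simp: matrix_matrix_mult_def vec_eq_iff sum.distrib algebra_simps sum_distrib_left)

lemmas mm_add_left = bounded_bilinear.add_left[OF bounded_bilinear_mm]
lemmas mm_add_right = bounded_bilinear.add_right[OF bounded_bilinear_mm]
lemmas mm_diff_left = bounded_bilinear.diff_left[OF bounded_bilinear_mm]
lemmas mm_diff_right = bounded_bilinear.diff_right[OF bounded_bilinear_mm]
lemmas mm_minus_left = bounded_bilinear.minus_left[OF bounded_bilinear_mm]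
lemmas mm_minus_right = bounded_bilinear.minus_right[OF bounded_bilinear_mm]
lemmas mm_scaleR_left = bounded_bilinear.scaleR_left[OF bounded_bilinear_mm]
lemmas mm_scaleR_right = bounded_bilinear.scaleR_right[OF bounded_bilinear_mm]
lemmas mm_distribs = mm_add_left mm_add_right mm_diff_left mm_diff_right
  mm_minus_left mm_minus_right mm_scaleR_left mm_scaleR_right
lemmas mm_assoc = matrix_mul_assoc[symmetric]

lemma has_vector_derivative_mm:
  fixes A :: "real \<Rightarrow> real^'m^'n" and B :: "real \<Rightarrow> real^'k^'m"
  assumes "(A has_vector_derivative A') (at t)" "(B has_vector_derivative B') (at t)"
  shows "((\<lambda>t. A t ** B t) has_vector_derivative (A t ** B' + A' ** B t)) (at t)"
  using bounded_bilinear.has_vector_derivative[OF bounded_bilinear_mm assms] by simp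

lemma bounded_linear_transpose: "bounded_linear (transpose :: real^'m^'n \<Rightarrow> real^'n^'m)"
  unfolding linear_conv_bounded_linear[symmetric] linear_iff
  by (auto simp: transpose_def vec_eq_iff)

lemmas transpose_add = linear_add[OF bounded_linear.linear[OF bounded_linear_transpose]]
lemmas transpose_diff = linear_diff[OF bounded_linear.linear[OF bounded_linear_transpose]]

lemmas has_vector_derivative_transpose =
  bounded_linear.has_vector_derivative[OF bounded_linear_transpose]

lemma has_vector_derivative_matrixI:
  fixes f :: "real \<Rightarrow> real^'m^'n"
  assumes "\<And>i j. ((\<lambda>t. f t $ i $ j) has_real_derivative f' $ i $ j) (at t)"
  shows "(f has_vector_derivative f') (at t)"
  unfolding has_vector_derivative_def
proof (subst has_derivative_componentwise_within, intro ballI)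
  fix b :: "real^'m^'n" assume "b \<in> Basis"
  then obtain i j where b: "b = axis i (axis j 1)" by (auto simp: Basis_vec_def)
  have "((\<lambda>t. f t $ i $ j) has_derivative (\<lambda>h. h * f' $ i $ j)) (at t)"
    using assms[of i j] by (simp add: has_field_derivative_def mult_commute_abs)
  then show "((\<lambda>x. f x \<bullet> b) has_derivative (\<lambda>x. (x *\<^sub>R f') \<bullet> b)) (at t)"
    by (simp add: b inner_axis)
qed

lemma matrix_power_bound:
  fixes A :: "real^'n^'n"
  shows "\<bar>matrix_power A k $ i $ j\<bar> \<le> (real CARD('n) * norm A) ^ k"
proof (induction k arbitrary: i)
  case 0 show ?case by (simp add: mat_def)
next
  case (Suc k)
  have e: "\<bar>A $ i $ l\<bar> \<le> norm A" for l
    by (rule order_trans[OF component_le_norm_cart Finite_Cartesian_Product.norm_nth_le])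
  have "\<bar>matrix_power A (Suc k) $ i $ j\<bar> \<le> (\<Sum>l\<in>UNIV. \<bar>A $ i $ l * matrix_power A k $ l $ j\<bar>)"
    by (simp add: matrix_matrix_mult_def sum_abs)
  also have "\<dots> \<le> (\<Sum>l\<in>(UNIV::'n set). norm A * (real CARD('n) * norm A) ^ k)"
    by (rule sum_mono) (simp add: abs_mult mult_mono e Suc)
  finally show ?case by (simp add: mult.assoc)
qed

lemma matrix_power_series_summable:
  fixes A :: "real^'n^'n"
  shows "summable (\<lambda>k. (matrix_power A k $ i $ j / fact k) * x ^ k)"
proof (rule summable_comparison_test')
  let ?M = "real CARD('n) * norm A"
  show "summable (\<lambda>k. (?M * \<bar>x\<bar>) ^ k / fact k)"
    using summable_exp[of "?M * \<bar>x\<bar>"] by (simp add: field_simps)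
  fix k :: nat
  show "norm ((matrix_power A k $ i $ j / fact k) * x ^ k) \<le> (?M * \<bar>x\<bar>) ^ k / fact k"
    using matrix_power_bound[of A k i j]
    by (simp add: abs_mult power_mult_distrib power_abs divide_right_mono mult_right_mono)
qed

lemma matrix_power_scaleR: "matrix_power (x *\<^sub>R A) k = x ^ k *\<^sub>R matrix_power A k"
  by (induction k) (auto simp: mm_distribs mult.commute)

lemma matrix_exp_nth:
  "matrix_exp (x *\<^sub>R A) $ i $ j = (\<Sum>k. (matrix_power A k $ i $ j / fact k) * x ^ k)"
proof -
  let ?f = "\<lambda>k. (1 / fact k) *\<^sub>R matrix_power (x *\<^sub>R A) k"
  have "?f sums (\<chi> i j. \<Sum>k. (matrix_power A k $ i $ j / fact k) * x ^ k)"
    unfolding sums_def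
  proof (intro vec_tendstoI)
    fix i j
    have "(\<lambda>n. \<Sum>k<n. (matrix_power A k $ i $ j / fact k) * x ^ k)
        \<longlonglongrightarrow> (\<Sum>k. (matrix_power A k $ i $ j / fact k) * x ^ k)"
      by (rule summable_LIMSEQ[OF matrix_power_series_summable])
    then show "(\<lambda>n. (\<Sum>k<n. ?f k) $ i $ j)
        \<longlonglongrightarrow> (\<chi> i j. \<Sum>k. (matrix_power A k $ i $ j / fact k) * x ^ k) $ i $ j"
      by (simp add: matrix_power_scaleR mult.commute)
  qed
  then show ?thesis unfolding matrix_exp_def by (simp add: sums_iff)
qed

lemma matrix_exp_0: "matrix_exp (0 :: real^'n^'n) = mat 1"
proof -
  have "matrix_exp (0 *\<^sub>R (0 :: real^'n^'n)) $ i $ j = mat 1 $ i $ j" for i j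
    unfolding matrix_exp_nth powser_zero by simp
  then show ?thesis by (simp add: vec_eq_iff)
qed

lemma has_vector_derivative_matrix_exp:
  fixes A :: "real^'n^'n"
  shows "((\<lambda>t. matrix_exp (t *\<^sub>R A)) has_vector_derivative A ** matrix_exp (t *\<^sub>R A)) (at t)"
proof (rule has_vector_derivative_matrixI)
  fix i j
  let ?c = "\<lambda>i k. matrix_power A k $ i $ j / fact k"
  have d: "diffs (?c i) k = (\<Sum>l\<in>UNIV. A $ i $ l * ?c l k)" for k
    by (simp add: diffs_def matrix_matrix_mult_def sum_divide_distrib[symmetric] del: of_nat_Suc)
  have "((\<lambda>t. \<Sum>k. ?c i k * t ^ k) has_real_derivative (\<Sum>k. diffs (?c i) k * t ^ k)) (at t)"
    by (rule termdiffs_strong_converges_everywhere) (rule matrix_power_series_summable)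
  also have "(\<Sum>k. diffs (?c i) k * t ^ k) = (\<Sum>k. \<Sum>l\<in>UNIV. A $ i $ l * (?c l k * t ^ k))"
    by (simp add: d sum_distrib_right mult.assoc)
  also have "\<dots> = (\<Sum>l\<in>UNIV. \<Sum>k. A $ i $ l * (?c l k * t ^ k))"
    by (rule suminf_sum) (intro summable_mult matrix_power_series_summable)
  also have "\<dots> = (A ** matrix_exp (t *\<^sub>R A)) $ i $ j"
    by (simp add: matrix_matrix_mult_def matrix_exp_nth suminf_mult matrix_power_series_summable
        del: times_divide_eq_left)
  finally show "((\<lambda>t. matrix_exp (t *\<^sub>R A) $ i $ j) has_real_derivative
      (A ** matrix_exp (t *\<^sub>R A)) $ i $ j) (at t)"
    by (simp add: matrix_exp_nth)
qed


lemma matrix_ode_unique: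
  fixes c :: "real \<Rightarrow> real^'n^'n"
  assumes E: "\<And>t. (c has_vector_derivative c' t) (at t)" and z: "\<And>t. c' t = 0"
  shows "c t = c 0"
proof -
  have "(c has_vector_derivative 0) (at x within UNIV)" for x
    using E[of x] z[of x] by simp
  then obtain k where "\<And>x. x \<in> UNIV \<Longrightarrow> c x = k"
    using has_vector_derivative_zero_constant[of UNIV c] by blast
  then show ?thesis by simp
qed

lemma has_vector_derivative_matrix_exp_minus:
  fixes A :: "real^'n^'n"
  shows "((\<lambda>t. matrix_exp (- t *\<^sub>R A)) has_vector_derivative - (A ** matrix_exp (- t *\<^sub>R A))) (at t)"
proof -
  have "((\<lambda>t. matrix_exp (t *\<^sub>R (- A))) has_vector_derivative
      (- A) ** matrix_exp (t *\<^sub>R (- A))) (at t)"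
    by (rule has_vector_derivative_matrix_exp)
  then show ?thesis by (simp add: mm_distribs)
qed

lemma matrix_power_commute: "A ** matrix_power A k = matrix_power A k ** A"
  by (induction k) (auto simp: matrix_mul_assoc)

lemma matrix_exp_commute:
  fixes A :: "real^'n^'n"
  shows "A ** matrix_exp (t *\<^sub>R A) = matrix_exp (t *\<^sub>R A) ** A"
proof -
  have "(A ** matrix_exp (t *\<^sub>R A)) $ i $ j = (matrix_exp (t *\<^sub>R A) ** A) $ i $ j" for i j
  proof -
    have "(\<lambda>k. \<Sum>l\<in>UNIV. A $ i $ l * (matrix_power A k $ l $ j / fact k * t ^ k))
        sums ((A ** matrix_exp (t *\<^sub>R A)) $ i $ j)"
      unfolding matrix_matrix_mult_def
      by (simp add: matrix_exp_nth del: times_divide_eq_left times_divide_eq_right)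
        (intro sums_sum sums_mult summable_sums matrix_power_series_summable)
    moreover have "(\<lambda>k. \<Sum>l\<in>UNIV. (matrix_power A k $ i $ l / fact k * t ^ k) * A $ l $ j)
        sums ((matrix_exp (t *\<^sub>R A) ** A) $ i $ j)"
      unfolding matrix_matrix_mult_def
      by (simp add: matrix_exp_nth del: times_divide_eq_left times_divide_eq_right)
        (intro sums_sum sums_mult2 summable_sums matrix_power_series_summable)
    moreover have "(\<Sum>l\<in>UNIV. A $ i $ l * (matrix_power A k $ l $ j / fact k * t ^ k)) =
        (\<Sum>l\<in>UNIV. (matrix_power A k $ i $ l / fact k * t ^ k) * A $ l $ j)" for k
    proof -
      have "(A ** matrix_power A k) $ i $ j * (t ^ k / fact k) =
          (matrix_power A k ** A) $ i $ j * (t ^ k / fact k)"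
        by (simp only: matrix_power_commute)
      then show ?thesis
        unfolding matrix_matrix_mult_def by (simp add: sum_distrib_left sum_distrib_right mult_ac sum_divide_distrib)
    qed
    ultimately show ?thesis by (simp add: sums_unique2)
  qed
  then show ?thesis by (simp add: vec_eq_iff)
qed

lemma matrix_exp_inverse:
  fixes A :: "real^'n^'n"
  shows "matrix_exp (t *\<^sub>R A) ** matrix_exp (- t *\<^sub>R A) = mat 1"
    and "matrix_exp (- t *\<^sub>R A) ** matrix_exp (t *\<^sub>R A) = mat 1"
proof -
  have c: "A ** (matrix_exp (t *\<^sub>R A) ** X) = matrix_exp (t *\<^sub>R A) ** (A ** X)" for X :: "real^'n^'n" and t
    by (simp add: matrix_mul_assoc matrix_exp_commute)
  have "matrix_exp (t *\<^sub>R A) ** matrix_exp (- t *\<^sub>R A)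
      = matrix_exp (0 *\<^sub>R A) ** matrix_exp (- 0 *\<^sub>R A)"
    by (rule matrix_ode_unique[OF has_vector_derivative_mm[OF has_vector_derivative_matrix_exp
            has_vector_derivative_matrix_exp_minus]])
      (simp add: mm_distribs mm_assoc c)
  then show *: "matrix_exp (t *\<^sub>R A) ** matrix_exp (- t *\<^sub>R A) = mat 1"
    by (simp add: matrix_exp_0)
  then show "matrix_exp (- t *\<^sub>R A) ** matrix_exp (t *\<^sub>R A) = mat 1"
    by (simp add: matrix_left_right_inverse)
qed

lemma matrix_exp_transpose_skew:
  fixes A :: "real^'n^'n"
  assumes "transpose A = - A"
  shows "transpose (matrix_exp (t *\<^sub>R A)) = matrix_exp (- t *\<^sub>R A)"
proof -
  let ?E = "\<lambda>t. matrix_exp (t *\<^sub>R A)"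
  have d: "((\<lambda>t. transpose (?E t)) has_vector_derivative - (transpose (?E t) ** A)) (at t)" for t
    using has_vector_derivative_transpose[OF has_vector_derivative_matrix_exp[of A t]]
    by (simp add: matrix_transpose_mul assms mm_distribs)
  have "transpose (?E t) ** ?E t = transpose (?E 0) ** ?E 0"
    by (rule matrix_ode_unique[OF has_vector_derivative_mm[OF d has_vector_derivative_matrix_exp]])
      (simp add: mm_distribs mm_assoc)
  then have "transpose (?E t) ** ?E t ** matrix_exp (- t *\<^sub>R A) = matrix_exp (- t *\<^sub>R A)"
    by (simp add: matrix_exp_0)
  then show ?thesis using matrix_exp_inverse(1)[of t A] by (simp add: mm_assoc)
qed

lemma grassmann_normal_commute:
  fixes N P :: "real^'n^'n"
  assumes P: "transpose P = P" "P ** P = P" and N: "transpose N = N"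
    and normal: "\<And>D. D \<in> grassmann_tangent P \<Longrightarrow> trace (N ** D) = 0"
  shows "N ** P = P ** N"
proof -
  have PP: "P ** (P ** X) = P ** X" for X :: "real^'n^'n"
    by (simp add: matrix_mul_assoc P)
  define C where "C = N ** P - P ** N"
  define D where "D = C ** P - P ** C"
  have "transpose C = - C"
    by (simp add: C_def transpose_diff matrix_transpose_mul P N)
  moreover have "transpose D = D"
    by (simp add: D_def transpose_diff matrix_transpose_mul P \<open>transpose C = - C\<close> mm_distribs)
  moreover have "D ** P + P ** D = D"
    unfolding D_def C_def by (simp only: mm_distribs mm_assoc P PP) simp
  ultimately have "trace (N ** D) = 0" using normal by (simp add: grassmann_tangent_def)
  moreover have "trace (N ** D) = trace (C ** (P ** N)) - trace (C ** (N ** P))"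
  proof -
    have "trace (N ** (C ** P)) = trace (C ** (P ** N))"
      using trace_mul_sym[of N "C ** P"] by (simp add: mm_assoc)
    moreover have "trace (N ** (P ** C)) = trace (C ** (N ** P))"
      using trace_mul_sym[of "N ** P" C] by (simp add: mm_assoc)
    ultimately show ?thesis by (simp add: D_def mm_distribs trace_sub)
  qed
  moreover have "\<dots> = trace (transpose C ** C)"
    unfolding \<open>transpose C = - C\<close> by (simp add: C_def mm_distribs trace_sub trace_add)
  ultimately have "trace (transpose C ** C) = 0" by simp
  then have "(\<Sum>i\<in>UNIV. \<Sum>k\<in>UNIV. C $ k $ i * C $ k $ i) = 0"
    by (simp add: trace_def matrix_matrix_mult_def transpose_def)
  then have "C $ k $ i = 0" for i k
    by (simp add: sum_nonneg_eq_0_iff sum_nonneg)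
  then have "C = 0" by (simp add: vec_eq_iff)
  then show ?thesis by (simp add: C_def)
qed

lemma grassmann_geodesic_matrix_exp:
  fixes P D :: "real^'n^'n"
  assumes P: "P \<in> grassmann p" and D: "D \<in> grassmann_tangent P"
  defines "W \<equiv> D ** P - P ** D"
  defines "c \<equiv> \<lambda>t. matrix_exp (t *\<^sub>R W) ** P ** matrix_exp (- t *\<^sub>R W)"
  shows "grassmann_geodesic p c" "c 0 = P" "(c has_vector_derivative D) (at 0)"
proof -
  have Ps: "transpose P = P" "P ** P = P" "rank P = p" using P by (auto simp: grassmann_def)
  have Ds: "transpose D = D" "D ** P + P ** D = D" using D by (auto simp: grassmann_tangent_def)
  have PP: "P ** (P ** X) = P ** X" for X :: "real^'n^'n"
    by (simp add: matrix_mul_assoc Ps)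
  have W: "transpose W = - W"
    by (simp add: W_def transpose_diff matrix_transpose_mul Ps Ds)
  have "P ** (D ** P + P ** D) ** P = P ** D ** P" by (simp add: Ds)
  then have PDP: "P ** (D ** P) = 0"
    by (simp add: mm_distribs mm_assoc Ps PP)
  have PWP: "P ** (W ** P) = 0"
    by (simp add: W_def mm_distribs mm_assoc Ps PP)
  have WD: "W ** P - P ** W = D"
  proof -
    have "W ** P - P ** W = D ** P + P ** D"
      by (simp add: W_def mm_distribs mm_assoc Ps PP PDP)
    then show ?thesis by (simp add: Ds)
  qed
  have WP: "W ** P + P ** W = W"
    by (simp add: W_def mm_distribs mm_assoc Ps PP PDP)
  let ?E = "\<lambda>t. matrix_exp (t *\<^sub>R W)" and ?F = "\<lambda>t. matrix_exp (- t *\<^sub>R W)"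
  have EF: "?E t ** (?F t ** X) = X" and FE: "?F t ** (?E t ** X) = X" for X :: "real^'n^'n" and t
    using matrix_exp_inverse[of t W] by (simp_all add: matrix_mul_assoc)
  have WE: "W ** ?E t = ?E t ** W" and WF: "W ** ?F t = ?F t ** W" for t
    using matrix_exp_commute[of W t] matrix_exp_commute[of W "- t"] by simp_all
  have tE: "transpose (?E t) = ?F t" and tF: "transpose (?F t) = ?E t" for t
    using matrix_exp_transpose_skew[OF W, of t] matrix_exp_transpose_skew[OF W, of "- t"] by simp_all
  show c0: "c 0 = P" by (simp add: c_def matrix_exp_0)
  have cG: "c t \<in> grassmann p" for t
  proof -
    have "transpose (c t) = c t"
      by (simp add: c_def matrix_transpose_mul tE tF Ps mm_assoc del: scaleR_minus_left)
    moreover have "c t ** c t = c t"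
      by (simp add: c_def mm_assoc FE[simplified] PP)
    moreover have "rank (c t) \<le> rank P"
      unfolding c_def by (meson order_trans rank_mul_le_left rank_mul_le_right)
    moreover have "P = ?F t ** c t ** ?E t"
      using matrix_exp_inverse(2)[of t W] by (simp add: c_def mm_assoc FE[simplified])
    then have "rank P \<le> rank (c t)"
      by (metis order_trans rank_mul_le_left rank_mul_le_right)
    ultimately show ?thesis using Ps by (simp add: grassmann_def)
  qed
  have d1: "(c has_vector_derivative (W ** c t - c t ** W)) (at t)" for t
    unfolding c_def
    by (rule has_vector_derivative_eq_rhs[OF has_vector_derivative_mm[OF has_vector_derivative_mm[OF
          has_vector_derivative_matrix_exp has_vector_derivative_const]
          has_vector_derivative_matrix_exp_minus]])
      (simp add: mm_distribs mm_assoc WF[simplified])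
  show "(c has_vector_derivative D) (at 0)"
    using d1[of 0] by (simp add: c0 WD)
  let ?c2 = "\<lambda>t. W ** (W ** c t - c t ** W) - (W ** c t - c t ** W) ** W"
  have d2: "((\<lambda>t. W ** c t - c t ** W) has_vector_derivative ?c2 t) (at t)" for t
    by (rule has_vector_derivative_eq_rhs[OF has_vector_derivative_diff[OF
          has_vector_derivative_mm[OF has_vector_derivative_const d1]
          has_vector_derivative_mm[OF d1 has_vector_derivative_const]]])
      (simp add: mm_distribs)
  have "grassmann_metric (c t) (?c2 t) X = 0" if X: "X \<in> grassmann_tangent (c t)" for t X
  proof -
    let ?G = "c t"
    have G: "?G ** ?G = ?G" using cG[of t] by (simp add: grassmann_def)
    have GG: "?G ** (?G ** Z) = ?G ** Z" for Z :: "real^'n^'n"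
      by (simp add: matrix_mul_assoc G)
    have Xs: "X ** ?G + ?G ** X = X" using X by (auto simp: grassmann_tangent_def)
    have "?G ** (X ** ?G + ?G ** X) ** ?G = ?G ** X ** ?G" by (simp add: Xs)
    then have GXG: "?G ** (X ** ?G) = 0" by (simp add: mm_distribs mm_assoc G GG)
    have WEx: "W ** (?E t ** Z) = ?E t ** (W ** Z)"
      and WFx: "W ** (?F t ** Z) = ?F t ** (W ** Z)" for Z :: "real^'n^'n"
      by (simp_all only: matrix_mul_assoc WE WF)
    have WG: "W ** ?G + ?G ** W = W"
    proof -
      have "W ** ?G + ?G ** W = ?E t ** ((W ** P + P ** W) ** ?F t)"
        by (simp only: c_def mm_assoc WEx WF mm_distribs)
      also have "\<dots> = W" by (simp only: WP WF EF)
      finally show ?thesis .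
    qed
    have "?G ** (W ** ?G + ?G ** W) ** ?G = ?G ** W ** ?G" by (simp add: WG)
    then have GWG: "?G ** (W ** ?G) = 0" by (simp add: mm_distribs mm_assoc G GG)
    have GWGx: "?G ** (W ** (?G ** Z)) = 0" for Z :: "real^'n^'n"
      using GWG by (metis matrix_mul_assoc times0_left)
    have WGe: "W ** ?G = W - ?G ** W" using WG by (simp add: eq_diff_eq)
    have WWG: "W ** (W ** ?G) = ?G ** (W ** W)"
    proof -
      have "W ** (W ** ?G) = W ** (W - ?G ** W)" by (simp only: WGe)
      also have "\<dots> = W ** W - (W ** ?G) ** W" by (simp only: mm_distribs mm_assoc)
      also have "\<dots> = ?G ** (W ** W)" by (simp only: WGe mm_distribs) (simp add: mm_assoc)
      finally show ?thesis .
    qed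
    define N where "N = ?c2 t"
    have NG: "N ** ?G = ?G ** N"
      by (simp only: N_def mm_distribs mm_assoc G GG GWG GWGx WWG) simp
    have "trace (N ** (X ** ?G)) = trace (N ** (X ** ?G) ** ?G)"
      by (simp add: mm_assoc G)
    also have "\<dots> = trace (?G ** (N ** (X ** ?G)))" by (rule trace_mul_sym)
    also have "\<dots> = trace ((N ** ?G) ** (X ** ?G))" by (simp only: NG mm_assoc)
    also have "\<dots> = 0" by (simp add: mm_assoc GXG trace_def)
    finally have 1: "trace (N ** (X ** ?G)) = 0" .
    have "trace (N ** (?G ** X)) = trace ((?G ** N) ** (?G ** X))"
      by (simp add: NG[symmetric] mm_assoc GG)
    also have "\<dots> = trace (?G ** (N ** (?G ** X)))" by (simp add: mm_assoc)
    also have "\<dots> = trace ((N ** (?G ** X)) ** ?G)" by (rule trace_mul_sym)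
    also have "\<dots> = 0" by (simp add: mm_assoc GXG trace_def)
    finally have 2: "trace (N ** (?G ** X)) = 0" .
    have "trace (N ** X) = trace (N ** (X ** ?G + ?G ** X))" by (simp add: Xs)
    also have "\<dots> = 0" using 1 2 by (simp add: mm_distribs trace_add)
    finally show ?thesis by (simp add: grassmann_metric_def N_def)
  qed
  with cG d1 d2 show "grassmann_geodesic p c"
    unfolding grassmann_geodesic_def
    by (intro conjI exI[of _ "\<lambda>t. W ** c t - c t ** W"] exI[of _ ?c2]) auto
qed

lemma grassmann_geodesic_unique:
  fixes c :: "real \<Rightarrow> real^'n^'n"
  assumes geo: "grassmann_geodesic p c" and c0: "(c has_vector_derivative D) (at 0)"
  defines "W \<equiv> D ** c 0 - c 0 ** D"
  shows "c t = matrix_exp (t *\<^sub>R W) ** c 0 ** matrix_exp (- t *\<^sub>R W)"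
proof -
  from geo obtain c1 c2 where
    G: "\<And>t. c t \<in> grassmann p" and
    d1: "\<And>t. (c has_vector_derivative c1 t) (at t)" and
    d2: "\<And>t. (c1 has_vector_derivative c2 t) (at t)" and
    n: "\<And>t D. D \<in> grassmann_tangent (c t) \<Longrightarrow> grassmann_metric (c t) (c2 t) D = 0"
    unfolding grassmann_geodesic_def by blast
  have cs: "transpose (c t) = c t" "c t ** c t = c t" for t
    using G[of t] by (auto simp: grassmann_def)
  have cc: "c t ** (c t ** X) = c t ** X" for X :: "real^'n^'n" and t
    by (simp add: matrix_mul_assoc cs)
  have c1s: "transpose (c1 t) = c1 t" for t
    by (rule vector_derivative_unique_at[OF has_vector_derivative_transpose[OF d1, unfolded cs] d1])
  have c2s: "transpose (c2 t) = c2 t" for t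
    by (rule vector_derivative_unique_at[OF has_vector_derivative_transpose[OF d2, unfolded c1s] d2])
  have c1t: "c t ** c1 t + c1 t ** c t = c1 t" for t
    by (rule vector_derivative_unique_at[OF has_vector_derivative_mm[OF d1 d1, unfolded cs] d1])
  have "c t ** (c t ** c1 t + c1 t ** c t) ** c t = c t ** c1 t ** c t" for t by (simp add: c1t)
  then have c1c: "c t ** (c1 t ** c t) = 0" for t by (simp add: mm_distribs mm_assoc cs cc)
  have comm: "c2 t ** c t = c t ** c2 t" for t
    by (rule grassmann_normal_commute[OF cs c2s]) (use n in \<open>auto simp: grassmann_metric_def\<close>)
  have "c1 0 = D" using vector_derivative_unique_at[OF d1 c0] .
  have Wc: "c1 t ** c t - c t ** c1 t = W" for t
  proof -
    have "c1 t ** c t - c t ** c1 t = c1 0 ** c 0 - c 0 ** c1 0"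
      by (rule matrix_ode_unique[OF has_vector_derivative_diff[OF
          has_vector_derivative_mm[OF d2 d1] has_vector_derivative_mm[OF d1 d2]]])
        (simp add: comm)
    then show ?thesis by (simp add: W_def \<open>c1 0 = D\<close>)
  qed
  have c1W: "c1 t = W ** c t - c t ** W" for t
  proof -
    have "W ** c t - c t ** W = c t ** c1 t + c1 t ** c t"
      by (simp add: Wc[of t, symmetric] mm_distribs mm_assoc cs cc c1c)
    then show ?thesis by (simp add: c1t)
  qed
  let ?E = "\<lambda>t. matrix_exp (t *\<^sub>R W)" and ?F = "\<lambda>t. matrix_exp (- t *\<^sub>R W)"
  have WE: "W ** (?E t ** X) = ?E t ** (W ** X)"
    and WF: "W ** (?F t ** X) = ?F t ** (W ** X)" for t and X :: "real^'n^'n"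
    using matrix_exp_commute[of W t] matrix_exp_commute[of W "- t"] by (simp_all add: matrix_mul_assoc)
  have "?F t ** c t ** ?E t = ?F 0 ** c 0 ** ?E 0"
    by (rule matrix_ode_unique[OF has_vector_derivative_mm[OF has_vector_derivative_mm[OF
          has_vector_derivative_matrix_exp_minus d1] has_vector_derivative_matrix_exp]])
      (simp add: c1W mm_distribs mm_assoc WF[simplified])
  then have "?E t ** (?F t ** c t ** ?E t) ** ?F t = ?E t ** c 0 ** ?F t"
    by (simp add: matrix_exp_0)
  moreover have "?E t ** (?F t ** c t ** ?E t) ** ?F t = (?E t ** ?F t) ** c t ** (?E t ** ?F t)"
    by (simp only: matrix_mul_assoc)
  ultimately show ?thesis by (simp add: matrix_exp_inverse[simplified])
qed

theorem grassmann_exp_eq: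
  fixes P D :: "real^'n^'n"
  assumes P: "P \<in> grassmann p" and D: "D \<in> grassmann_tangent P"
  shows "grassmann_exp P D =
    matrix_exp (D ** P - P ** D) ** P ** matrix_exp (- (D ** P - P ** D))"
    and "\<exists>!c. grassmann_geodesic (rank P) c \<and> c 0 = P \<and> (c has_vector_derivative D) (at 0)"
proof -
  let ?W = "D ** P - P ** D"
  let ?c = "\<lambda>t. matrix_exp (t *\<^sub>R ?W) ** P ** matrix_exp (- t *\<^sub>R ?W)"
  have r: "rank P = p" using P by (simp add: grassmann_def)
  have ex: "grassmann_geodesic (rank P) ?c" "?c 0 = P" "(?c has_vector_derivative D) (at 0)"
    unfolding r by (fact grassmann_geodesic_matrix_exp[OF P D])+
  have un: "c = ?c" if "grassmann_geodesic (rank P) c" "c 0 = P" "(c has_vector_derivative D) (at 0)" for c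
  proof
    show "c t = ?c t" for t
      using grassmann_geodesic_unique[OF that(1,3), of t] unfolding that(2) .
  qed
  show "\<exists>!c. grassmann_geodesic (rank P) c \<and> c 0 = P \<and> (c has_vector_derivative D) (at 0)"
    using ex un by blast
  have "grassmann_exp P D = ?c 1"
    unfolding grassmann_exp_def
  proof (rule the_equality)
    show "\<exists>c. grassmann_geodesic (rank P) c \<and> c 0 = P \<and>
        (c has_vector_derivative D) (at 0) \<and> ?c 1 = c 1"
      using ex by (intro exI[of _ ?c] conjI refl)
    show "R = ?c 1" if R: "\<exists>c. grassmann_geodesic (rank P) c \<and> c 0 = P \<and>
        (c has_vector_derivative D) (at 0) \<and> R = c 1" for R
    proof -
      from R obtain c where "grassmann_geodesic (rank P) c" "c 0 = P"
        "(c has_vector_derivative D) (at 0)" and Rc: "R = c 1" by blast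
      from un[OF this(1-3)] show ?thesis unfolding Rc by (rule fun_cong)
    qed
  qed
  then show "grassmann_exp P D = matrix_exp ?W ** P ** matrix_exp (- ?W)" by simp
qed

end

theory Submission
  imports Defs
begin

text \<open>For a compact SVD \<open>\<Delta> U = Q \<Sigma> V\<^sup>T\<close> the curve \<open>Y(s) = U V cos(s\<Sigma>) + Q sin(s\<Sigma>)\<close> solves
  \<open>Y' = [\<Delta>,P] Y\<close>, because \<open>[\<Delta>,P]\<close> maps \<open>U V\<close> to \<open>Q \<Sigma>\<close> and \<open>Q \<Sigma>\<close> to \<open>- U V \<Sigma>\<^sup>2\<close>. Hence
  \<open>Y(1) = exp([\<Delta>,P]) U V\<close>, and the Grassmann exponential of \<open>\<Delta>\<close> is \<open>Y(1) Y(1)\<^sup>T\<close>. Applied to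
  \<open>\<Delta> + t \<Delta>'\<close> for all small \<open>t\<close>, this reduces the derivative of the exponential to the product
  rule for \<open>Y Y\<^sup>T\<close>.\<close>

section \<open>Algebra and calculus of functions of diagonal matrices\<close>

lemma matrix_mult_diag_fun_nth: "(A ** diag_fun f S) $ i $ j = A $ i $ j * f (S $ j $ j)"
  by (simp add: matrix_matrix_mult_def diag_fun_def if_distrib[of "\<lambda>x. _ * x"] cong: if_cong)

text \<open>Presents a diagonal matrix as a \<open>diag_fun\<close>, so that the rules for products
  of such matrices also cover \<open>S\<close> itself.\<close>

lemma diag_fun_ident: "(\<And>i j. i \<noteq> j \<Longrightarrow> S $ i $ j = 0) \<Longrightarrow> diag_fun (\<lambda>x. x) S = S"
  by (simp add: diag_fun_def vec_eq_iff)

lemma transpose_diag_fun: "transpose (diag_fun f S) = diag_fun f S"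
  by (simp add: diag_fun_def transpose_def vec_eq_iff)

lemma diag_fun_mult: "diag_fun f S ** diag_fun g S = diag_fun (\<lambda>x. f x * g x) S"
  by (simp add: vec_eq_iff matrix_mult_diag_fun_nth) (simp add: diag_fun_def)

lemma diag_fun_cos_sin_squares:
  "diag_fun cos S ** diag_fun cos S + diag_fun sin S ** diag_fun sin S = mat 1"
  unfolding diag_fun_mult
  by (simp add: vec_eq_iff diag_fun_def mat_def flip: power2_eq_square)

text \<open>Right multiplication by a diagonal matrix scales columns: column \<open>j\<close> of
  \<open>A\<close> vanishes wherever \<open>S $ j $ j\<close> is nonzero, and elsewhere the factor
  is \<open>f 0 = 0\<close>. With \<open>f = sin\<close> this passes from \<open>S\<close> to
  sin(sS) without dividing by the entries of \<open>S\<close>.\<close>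

lemma matrix_mult_diag_fun_eq_0:
  assumes S: "\<And>i j. i \<noteq> j \<Longrightarrow> S $ i $ j = 0" and A: "A ** S = 0" and "f 0 = 0"
  shows "A ** diag_fun f (s *\<^sub>R S) = 0"
proof -
  have "A $ i $ j * S $ j $ j = 0" for i j
    using A matrix_mult_diag_fun_nth[of A "\<lambda>x. x" S i j] by (simp add: diag_fun_ident S)
  then have "A $ i $ j * f (s * S $ j $ j) = 0" for i j
    using \<open>f 0 = 0\<close> by (metis mult_eq_0_iff)
  then show ?thesis by (simp add: vec_eq_iff matrix_mult_diag_fun_nth)
qed

lemma has_real_derivative_matrix_nth:
  fixes F :: "real \<Rightarrow> real^'m^'n"
  assumes "(F has_vector_derivative F') (at t)"
  shows "((\<lambda>t. F t $ i $ j) has_real_derivative F' $ i $ j) (at t)"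
  using bounded_linear.has_vector_derivative[OF bounded_linear_compose[OF
      bounded_linear_vec_nth bounded_linear_vec_nth] assms]
  by (simp add: has_real_derivative_iff_has_vector_derivative)

text \<open>Diagonality near \<open>t\<close> forces the off-diagonal entries of \<open>S'\<close>
  to vanish, and hence those of the claimed derivative, as they must since \<open>diag_fun\<close>
  is 0 there. On the diagonal this is the scalar chain rule.\<close>

lemma has_vector_derivative_diag_fun:
  fixes S :: "real \<Rightarrow> real^'p^'p"
  assumes S: "(S has_vector_derivative S') (at t)"
    and diag: "\<forall>\<^sub>F u in nhds t. \<forall>i j. i \<noteq> j \<longrightarrow> S u $ i $ j = 0"
    and f: "\<And>x. (f has_real_derivative f' x) (at x)"
  shows "((\<lambda>u. diag_fun f (S u)) has_vector_derivative diag_fun f' (S t) ** S') (at t)"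
proof (rule has_vector_derivative_matrixI)
  fix i j
  have S'0: "S' $ k $ l = 0" if "k \<noteq> l" for k l
  proof -
    have "\<forall>\<^sub>F u in nhds t. S u $ k $ l = 0"
      using diag by eventually_elim (use that in blast)
    then have "((\<lambda>u. S u $ k $ l) has_real_derivative 0) (at t)"
      by (subst DERIV_cong_ev[OF refl _ refl]) auto
    then show ?thesis
      using DERIV_unique[OF has_real_derivative_matrix_nth[OF S]] by blast
  qed
  \<comment> \<open>Once \<open>S'\<close> is written as a \<open>diag_fun\<close>, the
    column-scaling formula gives the entries of the product.\<close>
  then have "diag_fun f' (S t) ** S' = diag_fun f' (S t) ** diag_fun (\<lambda>x. x) S'"
    by (simp add: diag_fun_ident)
  then have eq: "(diag_fun f' (S t) ** S') $ i $ j = (if i = j then f' (S t $ i $ i) * S' $ i $ i else 0)"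
    by (simp add: matrix_mult_diag_fun_nth) (simp add: diag_fun_def)
  show "((\<lambda>u. diag_fun f (S u) $ i $ j) has_real_derivative (diag_fun f' (S t) ** S') $ i $ j) (at t)"
    unfolding eq using DERIV_chain2[OF f has_real_derivative_matrix_nth[OF S]]
    by (simp add: diag_fun_def)
qed

section \<open>The frame Y and its derivative\<close>

text \<open>The SVD factors are arguments because Y is differentiated along two curves: scaling
  \<open>S\<close> by \<open>s\<close> in a fixed SVD, and moving all three factors with
  \<open>t\<close>.\<close>

definition svd_frame :: "real^'p^'n \<Rightarrow> real^'p^'n \<Rightarrow> real^'p^'p \<Rightarrow> real^'p^'p \<Rightarrow> real^'p^'n" where
  "svd_frame U Q S V = U ** V ** diag_fun cos S + Q ** diag_fun sin S"

text \<open>The product rule, giving \<Gamma> in general form. With constant \<open>Q\<close> and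
  \<open>V\<close> it also yields the differential equation in \<open>s\<close>.\<close>

lemma has_vector_derivative_svd_frame:
  fixes U :: "real^'p^'n"
  assumes Q: "(Q has_vector_derivative Q') (at t)" and S: "(S has_vector_derivative S') (at t)"
    and V: "(V has_vector_derivative V') (at t)"
    and diag: "\<forall>\<^sub>F u in nhds t. \<forall>i j. i \<noteq> j \<longrightarrow> S u $ i $ j = 0"
  shows "((\<lambda>u. svd_frame U (Q u) (S u) (V u)) has_vector_derivative
    U ** V' ** diag_fun cos (S t) - U ** V t ** diag_fun sin (S t) ** S'
    + Q' ** diag_fun sin (S t) + Q t ** diag_fun cos (S t) ** S') (at t)"
proof -
  have "((\<lambda>u. diag_fun cos (S u)) has_vector_derivative diag_fun (\<lambda>x. - sin x) (S t) ** S') (at t)"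
    by (rule has_vector_derivative_diag_fun[OF S diag]) (rule DERIV_cos)
  moreover have "diag_fun (\<lambda>x. - sin x) (S t) = - diag_fun sin (S t)"
    by (simp add: diag_fun_def vec_eq_iff)
  ultimately have c: "((\<lambda>u. diag_fun cos (S u)) has_vector_derivative - (diag_fun sin (S t) ** S')) (at t)"
    by (simp add: mm_distribs)
  have s: "((\<lambda>u. diag_fun sin (S u)) has_vector_derivative diag_fun cos (S t) ** S') (at t)"
    by (rule has_vector_derivative_diag_fun[OF S diag]) (rule DERIV_sin)
  show ?thesis
    unfolding svd_frame_def
    by (rule has_vector_derivative_eq_rhs[OF has_vector_derivative_add[OF
          has_vector_derivative_mm[OF has_vector_derivative_mm[OF has_vector_derivative_const V] c]
          has_vector_derivative_mm[OF Q s]]])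
      (simp add: mm_distribs mm_assoc)
qed

section \<open>A single SVD: the commutator [D,P] and the exponential of D\<close>

context
  fixes U Q :: "real^'p^'n" and P D :: "real^'n^'n" and S V :: "real^'p^'p"
  assumes U: "U \<in> stiefel" and P: "P = U ** transpose U" and D: "D \<in> grassmann_tangent P"
    and svd: "compact_svd (horizontal_lift U D) Q S V"
begin

lemma stiefel_cancel: "transpose U ** U = mat 1" "transpose U ** (U ** X) = X"
  using U by (simp_all add: stiefel_def matrix_mul_assoc)

lemma svd_diagonal: "i \<noteq> j \<Longrightarrow> S $ i $ j = 0"
  using svd by (simp add: compact_svd_def)

lemma svd_right_orthogonal:
  "transpose V ** V = mat 1" "V ** transpose V = mat 1" "transpose V ** (V ** X) = X"
  using svd by (simp_all add: compact_svd_def orthogonal_matrix_def matrix_mul_assoc)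

lemma svd_left_orthonormal: "transpose Q ** Q = mat 1" "transpose Q ** (Q ** X) = X"
  using svd by (simp_all add: compact_svd_def stiefel_def matrix_mul_assoc)

lemma svd_mult_right: "D ** (U ** V) = Q ** S"
proof -
  have "D ** U = Q ** S ** transpose V"
    using svd by (simp add: compact_svd_def horizontal_lift_def)
  from arg_cong[OF this, of "\<lambda>X. X ** V"] show ?thesis by (simp add: mm_assoc svd_right_orthogonal)
qed

lemma tangent_symmetric: "transpose D = D" and tangent_eq: "D ** P + P ** D = D"
  using D by (auto simp: grassmann_tangent_def)

text \<open>Sandwiching D P + P D = D between U^T and U gives 2 U^T D U = U^T D U.\<close>

lemma tangent_horizontal: "transpose U ** (D ** (U ** X)) = 0"
proof -
  have "transpose U ** (D ** P + P ** D) ** U = transpose U ** D ** U"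
    by (simp add: tangent_eq)
  then have "transpose U ** (D ** U) = 0"
    by (simp add: P mm_distribs mm_assoc stiefel_cancel)
  then show ?thesis by (metis matrix_mul_assoc times0_left)
qed

text \<open>Stated for \<open>Q ** S\<close>, which equals \<open>D ** (U ** V)\<close>; a column of
  \<open>Q\<close> at a zero entry of \<open>S\<close> need not be orthogonal to
  \<open>U\<close>.\<close>

lemma svd_left_horizontal: "transpose U ** (Q ** S) = 0"
  using tangent_horizontal[of V] by (simp add: svd_mult_right)

lemma commutator_mult_right: "(D ** P - P ** D) ** (U ** V) = Q ** S"
  using tangent_horizontal[of V]
  by (simp add: P mm_distribs mm_assoc stiefel_cancel svd_mult_right)

text \<open>The term D P vanishes on Q S by horizontality. For P D, transposing D U V = Q S gives
  V^T U^T D = S Q^T, hence U^T D Q S = V S^2.\<close>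

lemma commutator_mult_left: "(D ** P - P ** D) ** (Q ** S) = - (U ** (V ** (S ** S)))"
proof -
  have St: "transpose S = S"
    using transpose_diag_fun[of "\<lambda>x. x" S] by (simp add: diag_fun_ident svd_diagonal)
  have "transpose (D ** (U ** V)) = transpose (Q ** S)"
    by (simp add: svd_mult_right)
  then have "transpose V ** (transpose U ** D) = S ** transpose Q"
    by (simp add: matrix_transpose_mul tangent_symmetric mm_assoc St)
  then have "(transpose V ** (transpose U ** D)) ** (Q ** S) = S ** transpose Q ** (Q ** S)"
    by simp
  then have "transpose V ** (transpose U ** (D ** (Q ** S))) = S ** S"
    by (simp add: mm_assoc svd_left_orthonormal)
  then have "V ** (transpose V ** (transpose U ** (D ** (Q ** S)))) = V ** (S ** S)"
    by simp
  then have "transpose U ** (D ** (Q ** S)) = V ** (S ** S)"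
    by (simp add: matrix_mul_assoc svd_right_orthogonal)
  then show ?thesis
    by (simp add: P mm_distribs mm_assoc svd_left_horizontal)
qed

lemma svd_frame_ode:
  "((\<lambda>s. svd_frame U Q (s *\<^sub>R S) V) has_vector_derivative
    (D ** P - P ** D) ** svd_frame U Q (s *\<^sub>R S) V) (at s)"
proof -
  let ?W = "D ** P - P ** D" and ?C = "diag_fun cos (s *\<^sub>R S)" and ?N = "diag_fun sin (s *\<^sub>R S)"
  have comm: "diag_fun f (s *\<^sub>R S) ** S = S ** diag_fun f (s *\<^sub>R S)" for f
  proof -
    \<comment> \<open>Both factors become functions of the same matrix \<open>S\<close>, and such
      functions commute.\<close>
    have "diag_fun f (s *\<^sub>R S) = diag_fun (\<lambda>x. f (s * x)) S"
      by (simp add: diag_fun_def vec_eq_iff)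
    then show ?thesis
      using diag_fun_mult[of "\<lambda>x. f (s * x)" S "\<lambda>x. x"] diag_fun_mult[of "\<lambda>x. x" S "\<lambda>x. f (s * x)"]
      by (simp add: diag_fun_ident svd_diagonal mult.commute)
  qed
  \<comment> \<open>The action of \<open>?W\<close> is known on \<open>Q ** S\<close> only, whereas
    Y contains \<open>Q ** ?N\<close>. Since sin vanishes at 0, the trailing \<open>S\<close> can be
    exchanged for \<open>?N\<close>.\<close>
  have "(?W ** Q + U ** V ** S) ** S = 0"
    using commutator_mult_left by (simp add: mm_add_left mm_assoc)
  then have "(?W ** Q + U ** V ** S) ** ?N = 0"
    by (intro matrix_mult_diag_fun_eq_0) (auto simp: svd_diagonal)
  then have WQ: "?W ** (Q ** ?N) = - (U ** (V ** (?N ** S)))"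
    by (simp add: mm_add_left mm_assoc comm add_eq_0_iff2)
  have WU: "?W ** (U ** (V ** ?C)) = Q ** (?C ** S)"
    using arg_cong[OF commutator_mult_right, of "\<lambda>X. X ** ?C"] by (simp add: mm_assoc comm)
  have "((\<lambda>s. s *\<^sub>R S) has_vector_derivative S) (at s)"
    by (auto intro!: derivative_eq_intros)
  \<comment> \<open>The two zeros are the derivatives of the constant factors \<open>V\<close> and
    \<open>Q\<close>.\<close>
  then have "((\<lambda>s. svd_frame U Q (s *\<^sub>R S) V) has_vector_derivative
      U ** 0 ** ?C - U ** V ** ?N ** S + 0 ** ?N + Q ** ?C ** S) (at s)"
    by (intro has_vector_derivative_svd_frame has_vector_derivative_const)
      (auto simp: svd_diagonal)
  then show ?thesis
    by (rule has_vector_derivative_eq_rhs)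
      (simp add: svd_frame_def mm_add_right mm_assoc WQ WU)
qed

text \<open>The mixed terms of Y^T Y contain U^T Q sin(S) or its transpose and vanish; what remains
  is cos^2 + sin^2 = 1 on the diagonal.\<close>

lemma svd_frame_stiefel: "svd_frame U Q S V \<in> stiefel"
proof -
  let ?C = "diag_fun cos S" and ?N = "diag_fun sin S"
  have "(transpose U ** Q) ** diag_fun sin (1 *\<^sub>R S) = 0"
    by (intro matrix_mult_diag_fun_eq_0) (auto simp: svd_diagonal mm_assoc svd_left_horizontal)
  then have UQ: "transpose U ** (Q ** ?N) = 0" by (simp add: mm_assoc)
  from arg_cong[OF this, of transpose]
  have QU: "?N ** (transpose Q ** (U ** X)) = 0" for X :: "real^'p^'p"
    by (simp add: matrix_transpose_mul transpose_diag_fun matrix_mul_assoc)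
      (simp add: transpose_def vec_eq_iff matrix_matrix_mult_def)
  have "transpose (svd_frame U Q S V) ** svd_frame U Q S V = ?C ** ?C + ?N ** ?N"
    by (simp add: svd_frame_def transpose_add matrix_transpose_mul transpose_diag_fun mm_distribs
        mm_assoc UQ QU stiefel_cancel svd_right_orthogonal svd_left_orthonormal)
  then show ?thesis
    by (simp add: stiefel_def diag_fun_cos_sin_squares)
qed

text \<open>Since \<open>?W\<close> commutes with its exponential, exp(-sW) Y(s) has derivative 0
  and keeps its initial value U V. Thus Y(1) = exp(W) U V, and in Y(1) Y(1)^T the factor V V^T
  cancels, leaving exp(W) P exp(-W).\<close>

lemma grassmann_exp_svd_frame:
  assumes "P \<in> grassmann p"
  shows "grassmann_exp P D = svd_frame U Q S V ** transpose (svd_frame U Q S V)"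
proof -
  let ?W = "D ** P - P ** D" and ?Y = "\<lambda>s. svd_frame U Q (s *\<^sub>R S) V"
  have W: "transpose ?W = - ?W"
    by (simp add: transpose_diff matrix_transpose_mul tangent_symmetric P mm_assoc)
  have WF: "?W ** (matrix_exp (- s *\<^sub>R ?W) ** X) = matrix_exp (- s *\<^sub>R ?W) ** (?W ** X)"
    for s and X :: "real^'p^'n"
    using matrix_exp_commute[of ?W "- s"] by (simp only: matrix_mul_assoc)
  have d: "((\<lambda>s. matrix_exp (- s *\<^sub>R ?W) ** ?Y s) has_vector_derivative 0) (at s)" for s
    by (rule has_vector_derivative_eq_rhs[OF has_vector_derivative_mm[OF
          has_vector_derivative_matrix_exp_minus svd_frame_ode]])
      (simp only: WF mm_minus_left mm_assoc add.right_inverse)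
  then obtain K where K: "\<And>s. matrix_exp (- s *\<^sub>R ?W) ** ?Y s = K"
    using has_vector_derivative_zero_constant[of UNIV "\<lambda>s. matrix_exp (- s *\<^sub>R ?W) ** ?Y s"] by auto
  have "?Y 0 = U ** V"
  proof -
    have "diag_fun cos (0 *\<^sub>R S) = mat 1" "diag_fun sin (0 *\<^sub>R S) = 0"
      by (simp_all add: diag_fun_def mat_def vec_eq_iff)
    then show ?thesis by (simp add: svd_frame_def)
  qed
  then have "K = U ** V"
    using K[of 0] by (simp add: matrix_exp_0)
  then have "matrix_exp ?W ** (matrix_exp (- ?W) ** ?Y 1) = matrix_exp ?W ** (U ** V)"
    using K[of 1] by simp
  then have Y: "svd_frame U Q S V = matrix_exp ?W ** (U ** V)"
    using matrix_exp_inverse(1)[of 1 ?W] by (simp add: matrix_mul_assoc)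
  have "transpose (matrix_exp ?W) = matrix_exp (- ?W)"
    using matrix_exp_transpose_skew[OF W, of 1] by simp
  then have "svd_frame U Q S V ** transpose (svd_frame U Q S V)
      = matrix_exp ?W ** (U ** ((V ** transpose V) ** (transpose U ** matrix_exp (- ?W))))"
    by (simp only: Y matrix_transpose_mul mm_assoc)
  also have "\<dots> = matrix_exp ?W ** P ** matrix_exp (- ?W)"
    unfolding svd_right_orthogonal by (simp add: P mm_assoc)
  finally show ?thesis
    using grassmann_exp_eq(1)[OF assms D] by simp
qed

end

section \<open>Tangent vectors and the map Y to Y Y^T\<close>

text \<open>Differentiate the identity Y^T Y = I, which holds on a neighbourhood of
  \<open>t\<close>.\<close>

lemma stiefel_tangent_if_has_vector_derivative:
  fixes Y :: "real \<Rightarrow> real^'p^'n"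
  assumes "\<forall>\<^sub>F u in nhds t. Y u \<in> stiefel" and Y: "(Y has_vector_derivative Y') (at t)"
  shows "Y' \<in> stiefel_tangent (Y t)"
proof -
  have "\<forall>\<^sub>F u in nhds t. transpose (Y u) ** Y u = mat 1"
    using assms(1) by (simp add: stiefel_def)
  then have "((\<lambda>u. transpose (Y u) ** Y u) has_vector_derivative 0) (at t)"
    by (subst has_vector_derivative_cong_ev[where g = "\<lambda>_. mat 1"])
      (auto dest: eventually_nhds_x_imp_x)
  then have "transpose (Y t) ** Y' + transpose Y' ** Y t = 0"
    using vector_derivative_unique_at
      has_vector_derivative_mm[OF has_vector_derivative_transpose[OF Y] Y] by blast
  then show ?thesis
    by (simp add: stiefel_tangent_def eq_neg_iff_add_eq_0)
qed

text \<open>Keeps the line \<Delta> + t \<Delta>' inside the tangent space, so that the formula for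
  the exponential applies at each small \<open>t\<close>.\<close>

lemma grassmann_tangent_add_scaleR:
  assumes "A \<in> grassmann_tangent P" "B \<in> grassmann_tangent P"
  shows "A + t *\<^sub>R B \<in> grassmann_tangent P"
proof -
  have "(A + t *\<^sub>R B) ** P + P ** (A + t *\<^sub>R B) = (A ** P + P ** A) + t *\<^sub>R (B ** P + P ** B)"
    by (simp add: mm_distribs scaleR_add_right)
  then show ?thesis
    using assms by (simp add: grassmann_tangent_def transpose_add transpose_scalar)
qed

text \<open>\<open>G ** transpose Y + Y ** transpose G\<close> is the derivative of Y Y^T in
  direction \<open>G\<close>. All three claims reduce to Y^T Y = I and Y^T G = -G^T Y.\<close>

lemma
  assumes Y: "Y \<in> stiefel" and G: "G \<in> stiefel_tangent Y"
  shows stiefel_tangent_push_forward: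
      "G ** transpose Y + Y ** transpose G \<in> grassmann_tangent (Y ** transpose Y)"
    and horizontal_lift_push_forward:
      "horizontal_lift Y (G ** transpose Y + Y ** transpose G) = (mat 1 - Y ** transpose Y) ** G"
    and horizontal_projection_eq:
      "(mat 1 - Y ** transpose Y) ** G = G + Y ** transpose G ** Y"
proof -
  have YY: "transpose Y ** Y = mat 1" "transpose Y ** (Y ** X) = X" for X
    using Y by (simp_all add: stiefel_def matrix_mul_assoc)
  have YG: "transpose Y ** G = - (transpose G ** Y)"
    using G by (simp add: stiefel_tangent_def)
  have YGx: "transpose Y ** (G ** X) = - (transpose G ** (Y ** X))" for X
    using arg_cong[OF YG, of "\<lambda>Z. Z ** X"] by (simp add: mm_distribs mm_assoc)
  show "G ** transpose Y + Y ** transpose G \<in> grassmann_tangent (Y ** transpose Y)"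
    by (simp add: grassmann_tangent_def transpose_add matrix_transpose_mul mm_distribs mm_assoc YY YGx)
  show *: "(mat 1 - Y ** transpose Y) ** G = G + Y ** transpose G ** Y"
    by (simp add: mm_distribs mm_assoc YG)
  show "horizontal_lift Y (G ** transpose Y + Y ** transpose G) = (mat 1 - Y ** transpose Y) ** G"
    unfolding * by (simp add: horizontal_lift_def mm_distribs mm_assoc YY)
qed

section \<open>Differentiating the exponential along \<Delta> + t \<Delta>'\<close>

theorem proposition3p4:
  fixes U :: "real^'p^'n" and P \<Delta> \<Delta>' :: "real^'n^'n"
    and Q Y \<Gamma> :: "real^'p^'n" and \<Sigma> V :: "real^'p^'p"
    and Qt :: "real \<Rightarrow> real^'p^'n" and \<Sigma>t Vt :: "real \<Rightarrow> real^'p^'p"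
    and Qdot :: "real^'p^'n" and \<Sigma>dot Vdot :: "real^'p^'p"
  assumes "CARD('p) \<le> CARD('n)"
    and "U \<in> stiefel" and "P = U ** transpose U" and "P \<in> grassmann CARD('p)"
    and "\<Delta> \<in> grassmann_tangent P" and "\<Delta>' \<in> grassmann_tangent P"
    and "distinct_nonzero_singular_values (horizontal_lift U \<Delta>)"
    and "compact_svd (horizontal_lift U \<Delta>) Q \<Sigma> V"
    and "\<forall>\<^sub>F t in nhds 0.
           compact_svd (horizontal_lift U (\<Delta> + t *\<^sub>R \<Delta>')) (Qt t) (\<Sigma>t t) (Vt t) \<and>
           Qt differentiable at t \<and> \<Sigma>t differentiable at t \<and> Vt differentiable at t"
    and "Qt 0 = Q" and "\<Sigma>t 0 = \<Sigma>" and "Vt 0 = V"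
    and "Qdot = vector_derivative Qt (at 0)" and "\<Sigma>dot = vector_derivative \<Sigma>t (at 0)"
    and "Vdot = vector_derivative Vt (at 0)"
    and "Y = U ** V ** diag_fun cos \<Sigma> + Q ** diag_fun sin \<Sigma>"
    and "\<Gamma> = U ** Vdot ** diag_fun cos \<Sigma> - U ** V ** diag_fun sin \<Sigma> ** \<Sigma>dot
           + Qdot ** diag_fun sin \<Sigma> + Q ** diag_fun cos \<Sigma> ** \<Sigma>dot"
  shows "Y \<in> stiefel \<and> \<Gamma> \<in> stiefel_tangent Y \<and>
    ((\<lambda>t. grassmann_exp P (\<Delta> + t *\<^sub>R \<Delta>')) has_vector_derivative
       (\<Gamma> ** transpose Y + Y ** transpose \<Gamma>)) (at 0) \<and>
    grassmann_dexp P \<Delta> \<Delta>' = \<Gamma> ** transpose Y + Y ** transpose \<Gamma> \<and>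
    \<Gamma> ** transpose Y + Y ** transpose \<Gamma> \<in> grassmann_tangent (grassmann_exp P \<Delta>) \<and>
    grassmann_exp P \<Delta> = Y ** transpose Y \<and>
    horizontal_lift Y (grassmann_dexp P \<Delta> \<Delta>') = (mat 1 - Y ** transpose Y) ** \<Gamma> \<and>
    (mat 1 - Y ** transpose Y) ** \<Gamma> = \<Gamma> + Y ** transpose \<Gamma> ** Y"
proof -
  let ?Y = "\<lambda>t. svd_frame U (Qt t) (\<Sigma>t t) (Vt t)"
  note tangent = grassmann_tangent_add_scaleR[OF \<open>\<Delta> \<in> grassmann_tangent P\<close> \<open>\<Delta>' \<in> grassmann_tangent P\<close>]
  note svd_t = assms(9)
  have Y0: "?Y 0 = Y"
    using assms(10-12,16) by (simp add: svd_frame_def)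
  have Yst: "\<forall>\<^sub>F t in nhds 0. ?Y t \<in> stiefel"
    using svd_t by eventually_elim (use svd_frame_stiefel[OF assms(2,3) tangent] in blast)
  \<comment> \<open>Each \<open>t\<close> near 0 supplies its own SVD, so the formula holds on a
    whole neighbourhood and may be differentiated at 0.\<close>
  have exp: "\<forall>\<^sub>F t in nhds 0. grassmann_exp P (\<Delta> + t *\<^sub>R \<Delta>') = ?Y t ** transpose (?Y t)"
    using svd_t by eventually_elim (use grassmann_exp_svd_frame[OF assms(2,3) tangent _ assms(4)] in blast)
  have "Qt differentiable at 0 \<and> \<Sigma>t differentiable at 0 \<and> Vt differentiable at 0"
    using eventually_nhds_x_imp_x[OF svd_t] by blast
  then have d: "(Qt has_vector_derivative Qdot) (at 0)" "(\<Sigma>t has_vector_derivative \<Sigma>dot) (at 0)"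
      "(Vt has_vector_derivative Vdot) (at 0)"
    using assms(13-15) by (simp_all add: vector_derivative_works)
  \<comment> \<open>Diagonality near 0, not only at 0, is what the derivatives of cos(\<Sigma>(t))
    and sin(\<Sigma>(t)) rely on.\<close>
  have "\<forall>\<^sub>F t in nhds 0. \<forall>i j. i \<noteq> j \<longrightarrow> \<Sigma>t t $ i $ j = 0"
    using svd_t by eventually_elim (auto simp: compact_svd_def)
  from has_vector_derivative_svd_frame[OF d this, of U]
  have dY: "(?Y has_vector_derivative \<Gamma>) (at 0)"
    using assms(10-12,17) by simp
  have Y: "Y \<in> stiefel" and \<Gamma>: "\<Gamma> \<in> stiefel_tangent Y"
    using eventually_nhds_x_imp_x[OF Yst] stiefel_tangent_if_has_vector_derivative[OF Yst dY]
    by (simp_all add: Y0)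
  have exp0: "grassmann_exp P \<Delta> = Y ** transpose Y"
    using eventually_nhds_x_imp_x[OF exp] by (simp add: Y0)
  have "((\<lambda>t. ?Y t ** transpose (?Y t)) has_vector_derivative
      Y ** transpose \<Gamma> + \<Gamma> ** transpose Y) (at 0)"
    using has_vector_derivative_mm[OF dY has_vector_derivative_transpose[OF dY]] unfolding Y0 .
  \<comment> \<open>Transferring the derivative between curves that agree near 0 takes their
    agreement at 0 as a separate premise.\<close>
  moreover have "grassmann_exp P (\<Delta> + 0 *\<^sub>R \<Delta>') = ?Y 0 ** transpose (?Y 0)"
    using eventually_nhds_x_imp_x[OF exp] .
  ultimately have dexp: "((\<lambda>t. grassmann_exp P (\<Delta> + t *\<^sub>R \<Delta>')) has_vector_derivative
      \<Gamma> ** transpose Y + Y ** transpose \<Gamma>) (at 0)"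
    using exp by (subst has_vector_derivative_cong_ev[where g = "\<lambda>t. ?Y t ** transpose (?Y t)"])
      (auto elim: eventually_mono simp: add.commute)
  then have "grassmann_dexp P \<Delta> \<Delta>' = \<Gamma> ** transpose Y + Y ** transpose \<Gamma>"
    unfolding grassmann_dexp_def by (rule vector_derivative_at)
  then show ?thesis
    using Y \<Gamma> dexp exp0 stiefel_tangent_push_forward[OF Y \<Gamma>]
      horizontal_lift_push_forward[OF Y \<Gamma>] horizontal_projection_eq[OF Y \<Gamma>] by simp
qed

end
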